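(* A curve $C$ in the Myller configuration $M(C,\bar\xi,\pi)$ is a Darboux helix if and only if $C$ is a slant helix.
   Context: All data are smooth. Let $C$ be a curve in Euclidean space $E^3$ with arclength parameter $s\in I$ ($I$ an interval) and position vector $\bar r(s)$, let $\bar\xi(s)$ be a unit vector field along $C$ (a versor field $(C,\bar\xi)$), and let $\pi(s)$ be a plane field along $C$ with $\bar\xi(s)\in\pi(s)$. The pair $((C,\bar\xi),(C,\pi))$ is called a Myller configuration $M=M(C,\bar\xi,\pi)$. Put $\bar\xi_1=\bar\xi$, $K_1=\|d\bar\xi/ds\|>0$ (curvature), define $\bar\xi_2$ by $\bar\xi_1'=K_1\bar\xi_2$, and $\bar\xi_3=\bar\xi_1\times\bar\xi_2$. Then $\{\bar\xi_1,\bar\xi_2,\bar\xi_3\}$ is a positively oriented orthonormal frame, the Frenet-type frame $R_F$, and $$\bar\xi_1'=K_1\bar\xi_2,\quad \bar\xi_2'=-K_1\bar\xi_1+K_2\bar\xi_3,\quad \bar\xi_3'=-K_2\bar\xi_2,$$ which defines the torsion $K_2$. A prime denotes $d/ds$. Put $\bar Y=\bar\xi_2'/\|\bar\xi_2'\|$ and $\bar D=\bar\xi_2\times\bar Y=\frac{K_2}{\sqrt{K_1^2+K_2^2}}\bar\xi_1+\frac{K_1}{\sqrt{K_1^2+K_2^2}}\bar\xi_3$. The curve $C$ is called a slant helix (or $\bar\xi_2$-helix) in $M$ if $\bar\xi_2$ makes a constant angle with a fixed unit vector, and a Darboux helix in $M$ if $\bar D$ makes a constant angle with a constant unit vector. 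*)

theory Defs
  imports "HOL-Analysis.Analysis"
begin

text \<open>
  Derivatives are taken within the parameter interval, so that they are one-sided at an
  endpoint belonging to it.
\<close>

definition deriv_on :: "real set \<Rightarrow> (real \<Rightarrow> real^3) \<Rightarrow> real \<Rightarrow> real^3" where
  "deriv_on I f s = vector_derivative f (at s within I)"

definition smooth_on :: "real set \<Rightarrow> (real \<Rightarrow> real^3) \<Rightarrow> bool" where
  "smooth_on I f \<longleftrightarrow> (\<forall>n. \<forall>s\<in>I. (deriv_on I ^^ n) f differentiable (at s within I))"

record myller =
  param :: "real set"
  pos :: "real \<Rightarrow> real^3"
  versor :: "real \<Rightarrow> real^3"
  plane :: "real \<Rightarrow> (real^3) set"

text \<open>
  Vector fields along the curve take values in the space of free vectors; accordingly a plane
  of the plane field is given by its two-dimensional space of directions. Smoothness of the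
  plane field is expressed by a smooth unit normal, which exists globally because the
  parameter domain is an interval. The norm condition on the derivative of the position
  vector says that the parameter is arclength. The condition on the interior only excludes
  intervals that are empty or consist of one point.
\<close>

definition myller_configuration :: "myller \<Rightarrow> bool" where
  "myller_configuration M \<longleftrightarrow>
     is_interval (param M) \<and> interior (param M) \<noteq> {} \<and>
     smooth_on (param M) (pos M) \<and>
     (\<forall>s\<in>param M. norm (deriv_on (param M) (pos M) s) = 1) \<and>
     smooth_on (param M) (versor M) \<and>
     (\<forall>s\<in>param M. norm (versor M s) = 1) \<and>
     (\<exists>\<nu>. smooth_on (param M) \<nu> \<and>
          (\<forall>s\<in>param M. norm (\<nu> s) = 1 \<and> plane M s = {v. \<nu> s \<bullet> v = 0})) \<and>
     (\<forall>s\<in>param M. versor M s \<in> plane M s)"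

definition xi1 :: "myller \<Rightarrow> real \<Rightarrow> real^3" where
  "xi1 M = versor M"

definition K1 :: "myller \<Rightarrow> real \<Rightarrow> real" where
  "K1 M s = norm (deriv_on (param M) (xi1 M) s)"

definition xi2 :: "myller \<Rightarrow> real \<Rightarrow> real^3" where
  "xi2 M s = deriv_on (param M) (xi1 M) s /\<^sub>R K1 M s"

definition xi3 :: "myller \<Rightarrow> real \<Rightarrow> real^3" where
  "xi3 M s = cross3 (xi1 M s) (xi2 M s)"

text \<open>
  The torsion is the \<open>xi3\<close>-component of the derivative of \<open>xi2\<close>; that the Frenet formulas
  then hold is lemma \<open>frenet\<close> below.
\<close>

definition K2 :: "myller \<Rightarrow> real \<Rightarrow> real" where
  "K2 M s = deriv_on (param M) (xi2 M) s \<bullet> xi3 M s"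

definition Y_field :: "myller \<Rightarrow> real \<Rightarrow> real^3" where
  "Y_field M s =
     deriv_on (param M) (xi2 M) s /\<^sub>R norm (deriv_on (param M) (xi2 M) s)"

definition D_field :: "myller \<Rightarrow> real \<Rightarrow> real^3" where
  "D_field M s = cross3 (xi2 M s) (Y_field M s)"

definition vec_angle :: "real^3 \<Rightarrow> real^3 \<Rightarrow> real" where
  "vec_angle v w = arccos (v \<bullet> w / (norm v * norm w))"

definition slant_helix :: "myller \<Rightarrow> bool" where
  "slant_helix M \<longleftrightarrow>
     (\<exists>u \<theta>. norm u = 1 \<and> (\<forall>s\<in>param M. vec_angle (xi2 M s) u = \<theta>))"

definition darboux_helix :: "myller \<Rightarrow> bool" where
  "darboux_helix M \<longleftrightarrow>
     (\<exists>u \<theta>. norm u = 1 \<and> (\<forall>s\<in>param M. vec_angle (D_field M s) u = \<theta>))"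

lemma param_nontrivial:
  assumes "myller_configuration M" "s \<in> param M"
  shows "at s within param M \<noteq> bot"
proof -
  have c: "connected (param M)"
    using assms(1) unfolding myller_configuration_def by (simp add: is_interval_connected)
  have "\<nexists>a. param M = {a}"
    using assms(1) unfolding myller_configuration_def by auto
  then have "s islimpt param M"
    using connected_imp_perfect[OF c assms(2)] by blast
  then show ?thesis
    by (simp add: trivial_limit_within)
qed

lemma deriv_onI:
  assumes "myller_configuration M" "s \<in> param M"
    and "(f has_vector_derivative v) (at s within param M)"
  shows "deriv_on (param M) f s = v"
  unfolding deriv_on_def using vector_derivative_within param_nontrivial assms by blast

lemma inner_const_deriv:
  fixes f g :: "real \<Rightarrow> real^3"
  assumes "myller_configuration M" "s \<in> param M"
    and f: "(f has_vector_derivative f') (at s within param M)"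
    and g: "(g has_vector_derivative g') (at s within param M)"
    and c: "\<And>t. t \<in> param M \<Longrightarrow> f t \<bullet> g t = c"
  shows "f s \<bullet> g' + f' \<bullet> g s = 0"
proof -
  have "((\<lambda>t. f t \<bullet> g t) has_vector_derivative (f s \<bullet> g' + f' \<bullet> g s)) (at s within param M)"
    using bounded_bilinear.has_vector_derivative[OF bounded_bilinear_inner f g] .
  moreover have "((\<lambda>t. f t \<bullet> g t) has_vector_derivative 0) (at s within param M)"
    by (rule has_vector_derivative_transform[OF assms(2) c has_vector_derivative_const])
  ultimately show ?thesis
    using vector_derivative_unique_within[OF param_nontrivial[OF assms(1,2)]] by blast
qed

lemma orthonormal_expansion:
  assumes "norm a = 1" "norm b = 1" "a \<bullet> b = 0"
  shows "v = (v \<bullet> a) *\<^sub>R a + (v \<bullet> b) *\<^sub>R b + (v \<bullet> cross3 a b) *\<^sub>R cross3 a b"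
proof -
  define d where "d = v - ((v \<bullet> a) *\<^sub>R a + (v \<bullet> b) *\<^sub>R b)"
  have aa: "a \<bullet> a = 1" and bb: "b \<bullet> b = 1"
    using assms by (simp_all add: norm_eq_1)
  have da: "d \<bullet> a = 0" and db: "d \<bullet> b = 0"
    using aa bb assms(3) by (simp_all add: d_def algebra_simps inner_commute)
  have cc: "cross3 a b \<bullet> cross3 a b = 1"
    using norm_cross_dot[of a b] assms by (simp add: power2_norm_eq_inner)
  have "cross3 (cross3 a b) d = 0"
    using Lagrange[of d a b] da db cross_skew[of "cross3 a b" d]
    by (simp add: inner_commute)
  then have "cross3 (cross3 a b) (cross3 (cross3 a b) d) = 0"
    by simp
  then have "(cross3 a b \<bullet> d) *\<^sub>R cross3 a b - d = 0"
    using Lagrange[of "cross3 a b" "cross3 a b" d] cc by simp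
  moreover have "cross3 a b \<bullet> d = v \<bullet> cross3 a b"
    by (simp add: d_def inner_diff_right inner_add_right dot_cross_self inner_commute)
  ultimately show ?thesis
    by (simp add: d_def algebra_simps)
qed

lemma frenet:
  assumes M: "myller_configuration M" and pos: "\<And>t. t \<in> param M \<Longrightarrow> K1 M t > 0"
    and s: "s \<in> param M"
  shows "norm (xi1 M s) = 1" "norm (xi2 M s) = 1" "xi1 M s \<bullet> xi2 M s = 0"
    and "(xi1 M has_vector_derivative K1 M s *\<^sub>R xi2 M s) (at s within param M)"
    and "(xi2 M has_vector_derivative - K1 M s *\<^sub>R xi1 M s + K2 M s *\<^sub>R xi3 M s)
           (at s within param M)"
    and "(xi3 M has_vector_derivative - K2 M s *\<^sub>R xi2 M s) (at s within param M)"
proof -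
  let ?I = "param M"
  have sm: "smooth_on ?I (xi1 M)" and n1: "\<And>t. t \<in> ?I \<Longrightarrow> norm (xi1 M t) = 1"
    using M by (auto simp: myller_configuration_def xi1_def)
  show "norm (xi1 M s) = 1" by (rule n1[OF s])
  have d1: "(xi1 M has_vector_derivative K1 M t *\<^sub>R xi2 M t) (at t within ?I)" if "t \<in> ?I" for t
  proof -
    have "(deriv_on ?I ^^ 0) (xi1 M) differentiable (at t within ?I)"
      using sm that unfolding smooth_on_def by blast
    then show ?thesis
      using pos[OF that] by (simp add: vector_derivative_works deriv_on_def xi2_def)
  qed
  show "(xi1 M has_vector_derivative K1 M s *\<^sub>R xi2 M s) (at s within ?I)"
    by (rule d1[OF s])
  have n2: "norm (xi2 M t) = 1" if "t \<in> ?I" for t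
    using pos[OF that] by (simp add: xi2_def K1_def)
  show "norm (xi2 M s) = 1" by (rule n2[OF s])
  have o12: "xi1 M t \<bullet> xi2 M t = 0" if "t \<in> ?I" for t
  proof -
    have "xi1 M t \<bullet> (K1 M t *\<^sub>R xi2 M t) + (K1 M t *\<^sub>R xi2 M t) \<bullet> xi1 M t = 0"
      by (rule inner_const_deriv[OF M that d1[OF that] d1[OF that], of 1])
        (use n1 in \<open>simp add: norm_eq_1\<close>)
    then show ?thesis
      using pos[OF that] by (simp add: inner_commute)
  qed
  show "xi1 M s \<bullet> xi2 M s = 0" by (rule o12[OF s])
  have "(deriv_on ?I ^^ 1) (xi1 M) differentiable (at s within ?I)"
    using sm s unfolding smooth_on_def by blast
  then have df: "deriv_on ?I (xi1 M) differentiable (at s within ?I)" by simp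
  have nz: "deriv_on ?I (xi1 M) s \<noteq> 0"
    using pos[OF s] by (simp add: K1_def)
  have "(\<lambda>t. norm (deriv_on ?I (xi1 M) t)) differentiable (at s within ?I)"
    using differentiable_compose[OF differentiable_norm_at[OF nz] df] .
  then have "xi2 M differentiable (at s within ?I)"
    unfolding xi2_def [abs_def] K1_def
    by (intro differentiable_scaleR differentiable_inverse df) (use nz in auto)
  then have d2': "(xi2 M has_vector_derivative deriv_on ?I (xi2 M) s) (at s within ?I)"
    by (simp add: vector_derivative_works deriv_on_def)
  have a: "deriv_on ?I (xi2 M) s \<bullet> xi2 M s = 0"
    using inner_const_deriv[OF M s d2' d2', of 1] n2
    by (simp add: norm_eq_1 inner_commute)
  have "xi1 M s \<bullet> deriv_on ?I (xi2 M) s + (K1 M s *\<^sub>R xi2 M s) \<bullet> xi2 M s = 0"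
    by (rule inner_const_deriv[OF M s d1[OF s] d2', of 0]) (use o12 in simp)
  then have b: "deriv_on ?I (xi2 M) s \<bullet> xi1 M s = - K1 M s"
    using n2[OF s] by (simp add: norm_eq_1 inner_commute)
  have e: "deriv_on ?I (xi2 M) s = - K1 M s *\<^sub>R xi1 M s + K2 M s *\<^sub>R xi3 M s"
    using orthonormal_expansion[OF n1[OF s] n2[OF s] o12[OF s], of "deriv_on ?I (xi2 M) s"] a b
    by (simp add: K2_def xi3_def)
  show d2: "(xi2 M has_vector_derivative - K1 M s *\<^sub>R xi1 M s + K2 M s *\<^sub>R xi3 M s)
      (at s within ?I)"
    using d2' e by simp
  have "bounded_bilinear cross3"
    using bilinear_cross bilinear_conv_bounded_bilinear by blast
  from bounded_bilinear.has_vector_derivative[OF this d1[OF s] d2]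
  have d3: "(xi3 M has_vector_derivative
      cross3 (xi1 M s) (- K1 M s *\<^sub>R xi1 M s + K2 M s *\<^sub>R xi3 M s)
      + cross3 (K1 M s *\<^sub>R xi2 M s) (xi2 M s)) (at s within ?I)"
    by (simp add: xi3_def [abs_def])
  have "cross3 (xi1 M s) (xi3 M s) = - xi2 M s"
    using Lagrange[of "xi1 M s" "xi1 M s" "xi2 M s"] o12[OF s] n1[OF s]
    by (simp add: xi3_def norm_eq_1)
  then show "(xi3 M has_vector_derivative - K2 M s *\<^sub>R xi2 M s) (at s within ?I)"
    using d3 by (simp add: Cross3.right_diff_distrib cross_mult_right cross_mult_left)
qed

lemma D_field_eq:
  assumes M: "myller_configuration M" and pos: "\<And>t. t \<in> param M \<Longrightarrow> K1 M t > 0"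
    and s: "s \<in> param M"
  shows "D_field M s =
    (K2 M s / sqrt ((K1 M s)\<^sup>2 + (K2 M s)\<^sup>2)) *\<^sub>R xi1 M s +
    (K1 M s / sqrt ((K1 M s)\<^sup>2 + (K2 M s)\<^sup>2)) *\<^sub>R xi3 M s"
proof -
  note F = frenet[OF M pos s]
  let ?w = "- K1 M s *\<^sub>R xi1 M s + K2 M s *\<^sub>R xi3 M s"
  have e: "deriv_on (param M) (xi2 M) s = ?w"
    by (rule deriv_onI[OF M s F(5)])
  have i: "xi1 M s \<bullet> xi1 M s = 1" "xi2 M s \<bullet> xi2 M s = 1"
    using F by (simp_all add: norm_eq_1)
  have j: "xi3 M s \<bullet> xi3 M s = 1"
    using norm_cross_dot[of "xi1 M s" "xi2 M s"] F(1-3)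
    by (simp add: power2_norm_eq_inner xi3_def)
  have k: "xi1 M s \<bullet> xi3 M s = 0"
    by (simp add: xi3_def dot_cross_self)
  have n: "norm ?w = sqrt ((K1 M s)\<^sup>2 + (K2 M s)\<^sup>2)"
    using i j k
    by (simp add: norm_eq_sqrt_inner inner_add_left inner_add_right inner_diff_left
        inner_diff_right power2_eq_square inner_commute)
  have c1: "cross3 (xi2 M s) (xi1 M s) = - xi3 M s"
    by (simp add: xi3_def cross_skew[of "xi2 M s"])
  have c3: "cross3 (xi2 M s) (xi3 M s) = xi1 M s"
    using Lagrange[of "xi2 M s" "xi1 M s" "xi2 M s"] F(3) i
    by (simp add: xi3_def inner_commute)
  show ?thesis
    unfolding D_field_def Y_field_def e n
    by (simp add: cross_mult_right Cross3.right_diff_distrib c1 c3 divide_inverse_commute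
        scaleR_add_right)
qed

end

theory Submission
  imports Defs
begin

text \<open>
  The vectors \<open>xi2\<close>, \<open>Y\<close>, \<open>D\<close> form an orthonormal frame along the curve. Because \<open>xi2'\<close> is a
  positive multiple of \<open>Y\<close>, its derivative equations have Frenet form
  \<open>xi2' = w Y\<close>, \<open>Y' = - w xi2 - h D\<close>, \<open>D' = h Y\<close>
  with \<open>w > 0\<close> and \<open>w\<close>, \<open>h\<close> continuous (lemma \<open>darboux_frame\<close>). For a fixed unit vector \<open>u\<close>,
  a constant angle with \<open>u\<close> is the same as a constant inner product with \<open>u\<close>.

  If \<open>xi2 \<bullet> u\<close> is constant, then \<open>w (Y \<bullet> u) = 0\<close>, so \<open>Y \<bullet> u = 0\<close> and \<open>D \<bullet> u\<close> is constant:
  a slant helix is a Darboux helix with the same axis.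

  Conversely, let \<open>D \<bullet> u = c\<close>. This only gives \<open>h (Y \<bullet> u) = 0\<close>, and one factor could a priori
  vanish on one part of the interval and the other factor elsewhere. If \<open>xi2 \<bullet> u\<close> and
  \<open>Y \<bullet> u\<close> vanish together at some parameter, then \<open>u\<close> is \<open>D\<close> or \<open>- D\<close> there, so \<open>c = 1\<close>
  or \<open>c = - 1\<close>, hence \<open>D = c u\<close> along the whole curve and \<open>xi2\<close> stays orthogonal to \<open>u\<close>.
  If they never vanish together, then a connectedness argument
  (lemma \<open>nowhere_or_everywhere_nonzero\<close>) excludes the mixed case. If \<open>h\<close> vanishes
  identically, then \<open>D\<close> is a constant vector, orthogonal to \<open>xi2\<close>, and it serves as an axis in
  place of \<open>u\<close>. If \<open>h\<close> has no zero, then \<open>Y \<bullet> u = 0\<close> throughout and \<open>xi2 \<bullet> u\<close> is constant.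
\<close>

section \<open>Continuity and connectedness\<close>

lemma has_vector_derivative_imp_continuous_on:
  assumes "\<And>t. t \<in> I \<Longrightarrow> (f has_vector_derivative f' t) (at t within I)"
  shows "continuous_on I f"
  using assms has_vector_derivative_continuous
  unfolding continuous_on_eq_continuous_within by blast

text \<open>
  Where \<open>h \<noteq> 0\<close>, the function \<open>g\<close> vanishes in a whole neighbourhood by continuity of \<open>h\<close>, so
  \<open>g' = 0\<close> there as well, that is, \<open>w f + h c = 0\<close>. Conversely, where \<open>g = 0\<close> and
  \<open>w f + h c = 0\<close>, the value \<open>h = 0\<close> would force \<open>f = g = 0\<close>. So the open condition \<open>h \<noteq> 0\<close>
  is equivalent to a closed one, and connectedness decides.
\<close>

lemma nowhere_or_everywhere_nonzero:
  fixes f g h w :: "real \<Rightarrow> real"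
  assumes conn: "connected I" and perfect: "\<And>t. t \<in> I \<Longrightarrow> at t within I \<noteq> bot"
    and w: "continuous_on I w" "\<And>t. t \<in> I \<Longrightarrow> w t \<noteq> 0"
    and cont: "continuous_on I h" "continuous_on I f"
    and g': "\<And>t. t \<in> I \<Longrightarrow> (g has_vector_derivative - (w t * f t) - h t * c) (at t within I)"
    and hg: "\<And>t. t \<in> I \<Longrightarrow> h t * g t = 0"
    and nz: "\<And>t. t \<in> I \<Longrightarrow> f t \<noteq> 0 \<or> g t \<noteq> 0"
  shows "(\<forall>t\<in>I. h t = 0) \<or> (\<forall>t\<in>I. h t \<noteq> 0)"
proof -
  let ?A = "I \<inter> h -` (- {0})"
  let ?S = "(I \<inter> g -` {0}) \<inter> (I \<inter> (\<lambda>t. w t * f t + h t * c) -` {0})"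
  have opn: "openin (top_of_set I) ?A"
    by (rule continuous_openin_preimage_gen[OF cont(1)]) auto
  have gcont: "continuous_on I g"
    by (rule has_vector_derivative_imp_continuous_on[OF g'])
  have "continuous_on I (\<lambda>t. w t * f t + h t * c)"
    by (intro continuous_intros w cont)
  then have clo: "closedin (top_of_set I) ?S"
    using gcont by (intro closedin_Int continuous_closedin_preimage) auto
  have "?A \<subseteq> ?S"
  proof
    fix t assume t: "t \<in> ?A"
    then have tI: "t \<in> I" and ht: "h t \<noteq> 0" by auto
    have gt: "g t = 0" using hg[OF tI] ht by simp
    have "(h \<longlongrightarrow> h t) (at t within I)"
      using cont(1) tI by (simp add: continuous_on_def)
    then have "\<forall>\<^sub>F x in at t within I. h x \<noteq> 0"
      using ht by (rule tendsto_imp_eventually_ne)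
    moreover have "\<forall>\<^sub>F x in at t within I. x \<in> I"
      by (simp add: eventually_at_filter)
    ultimately have "\<forall>\<^sub>F x in at t within I. 0 = g x"
      by eventually_elim (use hg in force)
    then have "(g has_vector_derivative 0) (at t within I)"
      unfolding has_vector_derivative_def
      by (rule has_derivative_transform_eventually[rotated]) (use gt tI in auto)
    then have "- (w t * f t) - h t * c = 0"
      using vector_derivative_unique_within[OF perfect[OF tI] g'[OF tI]] by simp
    then show "t \<in> ?S" using tI gt by simp
  qed
  moreover have "?S \<subseteq> ?A"
    using w(2) nz by fastforce
  ultimately have "?A = ?S" by blast
  then have "?A = {} \<or> ?A = I"
    using conn opn clo unfolding connected_clopen by metis
  then show ?thesis by auto
qed

section \<open>Constant angles\<close>

lemma constant_angle_iff_constant_inner: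
  assumes v: "\<And>s. s \<in> I \<Longrightarrow> norm (v s) = 1" and u: "norm u = 1"
  shows "(\<exists>\<theta>. \<forall>s\<in>I. vec_angle (v s) u = \<theta>) \<longleftrightarrow> (\<exists>c. \<forall>s\<in>I. v s \<bullet> u = c)"
proof
  assume "\<exists>\<theta>. \<forall>s\<in>I. vec_angle (v s) u = \<theta>"
  then obtain \<theta> where \<theta>: "\<forall>s\<in>I. vec_angle (v s) u = \<theta>" ..
  have "v s \<bullet> u = cos \<theta>" if "s \<in> I" for s
  proof -
    have "\<bar>v s \<bullet> u\<bar> \<le> 1"
      using Cauchy_Schwarz_ineq2[of "v s" u] v[OF that] u by simp
    then show ?thesis
      using \<theta> v u that by (auto simp: vec_angle_def cos_arccos_abs)
  qed
  then show "\<exists>c. \<forall>s\<in>I. v s \<bullet> u = c" by blast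
qed (use v u in \<open>auto simp: vec_angle_def\<close>)

section \<open>The moving frame of principal normal, its derivative direction and Darboux vector\<close>

lemma iterated_deriv_on_has_vector_derivative:
  assumes "smooth_on I f" "s \<in> I"
  shows "((deriv_on I ^^ n) f has_vector_derivative (deriv_on I ^^ Suc n) f s) (at s within I)"
  using assms by (simp add: smooth_on_def deriv_on_def vector_derivative_works)

lemma bounded_bilinear_cross3: "bounded_bilinear cross3"
  using bilinear_cross bilinear_conv_bounded_bilinear by blast

text \<open>
  The identity holds because \<open>xi1' = K1 xi2\<close> and the term \<open>K1' xi2\<close> of \<open>xi1''\<close> is lost in the
  cross product. Its right-hand side is \<open>K1\<^sup>2 w D\<close> for \<open>w = norm xi2'\<close>. Thus \<open>D\<close> is the direction,
  and \<open>w\<close> up to the factor \<open>K1\<^sup>2\<close> the length, of a field built from the first two derivatives of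
  the versor; this is how \<open>D\<close> and \<open>w\<close> inherit their regularity from the versor.
\<close>

lemma cross3_deriv_xi1:
  assumes M: "myller_configuration M" and pos: "\<And>t. t \<in> param M \<Longrightarrow> K1 M t > 0"
    and s: "s \<in> param M"
  shows "cross3 ((deriv_on (param M) ^^ 1) (xi1 M) s) ((deriv_on (param M) ^^ 2) (xi1 M) s) =
    (K1 M s)\<^sup>2 *\<^sub>R cross3 (xi2 M s) (deriv_on (param M) (xi2 M) s)"
proof -
  let ?I = "param M" let ?F = "\<lambda>n. (deriv_on ?I ^^ n) (xi1 M)"
  have sm: "smooth_on ?I (xi1 M)"
    using M by (auto simp: myller_configuration_def xi1_def)
  have F1: "?F 1 t = K1 M t *\<^sub>R xi2 M t" if "t \<in> ?I" for t
    using pos[OF that] by (simp add: xi2_def)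
  have d2: "(xi2 M has_vector_derivative deriv_on ?I (xi2 M) s) (at s within ?I)"
    using frenet(5)[OF M pos s] deriv_onI[OF M s frenet(5)[OF M pos s]] by simp
  have dF: "(?F 1 has_vector_derivative ?F 2 s) (at s within ?I)"
    using iterated_deriv_on_has_vector_derivative[OF sm s, of 1] by (simp add: numeral_2_eq_2)
  have K: "K1 M t = ?F 1 t \<bullet> xi2 M t" if "t \<in> ?I" for t
    using F1[OF that] frenet(2)[OF M pos that] by (simp add: norm_eq_1)
  define k where "k = ?F 1 s \<bullet> deriv_on ?I (xi2 M) s + ?F 2 s \<bullet> xi2 M s"
  have "((\<lambda>t. ?F 1 t \<bullet> xi2 M t) has_vector_derivative k) (at s within ?I)"
    unfolding k_def by (rule bounded_bilinear.has_vector_derivative[OF bounded_bilinear_inner dF d2])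
  then have k: "(K1 M has_vector_derivative k) (at s within ?I)"
    by (rule has_vector_derivative_transform[OF s, rotated]) (rule K)
  have "((\<lambda>t. K1 M t *\<^sub>R xi2 M t) has_vector_derivative
      K1 M s *\<^sub>R deriv_on ?I (xi2 M) s + k *\<^sub>R xi2 M s) (at s within ?I)"
    by (rule bounded_bilinear.has_vector_derivative[OF bounded_bilinear_scaleR k d2])
  then have "(?F 1 has_vector_derivative K1 M s *\<^sub>R deriv_on ?I (xi2 M) s + k *\<^sub>R xi2 M s)
      (at s within ?I)"
    by (rule has_vector_derivative_transform[OF s, rotated]) (rule F1)
  then have "?F 2 s = K1 M s *\<^sub>R deriv_on ?I (xi2 M) s + k *\<^sub>R xi2 M s"
    by (rule vector_derivative_unique_within[OF param_nontrivial[OF M s] dF])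
  then show ?thesis
    unfolding F1[OF s]
    by (simp add: cross_mult_left cross_mult_right cross_add_right power2_eq_square)
qed

text \<open>
  The shape of the equations follows from orthonormality and \<open>xi2' = w Y\<close>. Continuity of
  the coefficients rests on the field \<open>B = xi1' \<times> xi1''\<close>, a positive multiple of \<open>D\<close> whose
  derivative is the cross product of \<open>xi1'\<close> with the third derivative of \<open>xi1\<close>:
  differentiating \<open>B \<bullet> Y = 0\<close> expresses \<open>h\<close> as \<open>(B' \<bullet> Y) / norm B\<close>.
\<close>

lemma darboux_frame:
  assumes M: "myller_configuration M" and pos: "\<And>t. t \<in> param M \<Longrightarrow> K1 M t > 0"
  obtains w h where "continuous_on (param M) w" "continuous_on (param M) h"
    and "\<And>t. t \<in> param M \<Longrightarrow> w t > 0"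
    and "\<And>t. t \<in> param M \<Longrightarrow> norm (xi2 M t) = 1"
    and "\<And>t. t \<in> param M \<Longrightarrow> norm (Y_field M t) = 1"
    and "\<And>t. t \<in> param M \<Longrightarrow> norm (D_field M t) = 1"
    and "\<And>t. t \<in> param M \<Longrightarrow> xi2 M t \<bullet> Y_field M t = 0"
    and "\<And>t. t \<in> param M \<Longrightarrow>
      (xi2 M has_vector_derivative w t *\<^sub>R Y_field M t) (at t within param M)"
    and "\<And>t. t \<in> param M \<Longrightarrow>
      (Y_field M has_vector_derivative - w t *\<^sub>R xi2 M t - h t *\<^sub>R D_field M t)
        (at t within param M)"
    and "\<And>t. t \<in> param M \<Longrightarrow>
      (D_field M has_vector_derivative h t *\<^sub>R Y_field M t) (at t within param M)"
proof -
  let ?I = "param M" let ?F = "\<lambda>n. (deriv_on ?I ^^ n) (xi1 M)"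
  let ?e = "xi2 M" and ?y = "Y_field M" and ?d = "D_field M"
  define w where "w = (\<lambda>t. norm (deriv_on ?I ?e t))"
  define B where "B = (\<lambda>t. cross3 (?F 1 t) (?F 2 t))"
  define h where "h = (\<lambda>t. (cross3 (?F 1 t) (?F 3 t) \<bullet> ?y t) / norm (B t))"
  have sm: "smooth_on ?I (xi1 M)"
    using M by (auto simp: myller_configuration_def xi1_def)
  note dF = iterated_deriv_on_has_vector_derivative[OF sm]
  have contF: "continuous_on ?I (?F n)" for n
    by (rule has_vector_derivative_imp_continuous_on[OF dF])
  have e1: "norm (?e t) = 1" if "t \<in> ?I" for t
    using frenet(2)[OF M pos that] .
  have de: "(?e has_vector_derivative deriv_on ?I ?e t) (at t within ?I)" if "t \<in> ?I" for t
    using frenet(5)[OF M pos that] deriv_onI[OF M that frenet(5)[OF M pos that]] by simp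
  have wpos: "w t > 0" if t: "t \<in> ?I" for t
  proof -
    have dxi: "(xi1 M has_vector_derivative K1 M t *\<^sub>R ?e t) (at t within ?I)"
      using frenet(4)[OF M pos t] .
    have o: "xi1 M x \<bullet> ?e x = 0" if "x \<in> ?I" for x
      using frenet(3)[OF M pos that] .
    have "xi1 M t \<bullet> deriv_on ?I ?e t + (K1 M t *\<^sub>R ?e t) \<bullet> ?e t = 0"
      by (rule inner_const_deriv[OF M t dxi de[OF t] o])
    then have "deriv_on ?I ?e t \<noteq> 0"
      using pos[OF t] e1[OF t] by (auto simp: norm_eq_1)
    then show ?thesis by (simp add: w_def)
  qed
  have wy: "deriv_on ?I ?e t = w t *\<^sub>R ?y t" and y1: "norm (?y t) = 1" if "t \<in> ?I" for t
    using wpos[OF that] by (simp_all add: w_def Y_field_def)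
  have ey: "?e t \<bullet> ?y t = 0" if t: "t \<in> ?I" for t
    using inner_const_deriv[OF M t de[OF t] de[OF t], of 1] e1 wy[OF t] wpos[OF t]
    by (simp add: norm_eq_1 inner_commute)
  have d1: "norm (?d t) = 1" if "t \<in> ?I" for t
    using norm_cross_dot[of "?e t" "?y t"] e1 y1 ey that
    by (simp add: D_field_def power2_eq_1_iff) (smt (verit) norm_ge_zero)
  have de0: "?d t \<bullet> ?e t = 0" and dy0: "?d t \<bullet> ?y t = 0" for t
    by (simp_all add: D_field_def dot_cross_self inner_commute)
  have Bd: "B t = ((K1 M t)\<^sup>2 * w t) *\<^sub>R ?d t" if "t \<in> ?I" for t
    using cross3_deriv_xi1[OF M pos that] wy[OF that]
    by (simp add: B_def D_field_def cross_mult_right)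
  have nB: "norm (B t) = (K1 M t)\<^sup>2 * w t" if "t \<in> ?I" for t
    using Bd[OF that] d1[OF that] wpos[OF that] by simp
  have nB0: "norm (B t) > 0" if "t \<in> ?I" for t
    using nB[OF that] wpos[OF that] pos[OF that] by simp
  have Bnd: "B t = norm (B t) *\<^sub>R ?d t" if "t \<in> ?I" for t
    using Bd nB that by simp
  have dB: "(B has_vector_derivative cross3 (?F 1 t) (?F 3 t)) (at t within ?I)" if t: "t \<in> ?I" for t
  proof -
    have "(?F 1 has_vector_derivative ?F 2 t) (at t within ?I)"
      "(?F 2 has_vector_derivative ?F 3 t) (at t within ?I)"
      using dF[OF t, of 1] dF[OF t, of 2] by (simp_all add: numeral_2_eq_2 numeral_3_eq_3)
    from bounded_bilinear.has_vector_derivative[OF bounded_bilinear_cross3 this]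
    show ?thesis by (simp add: B_def)
  qed
  have dd: "(?d has_vector_derivative deriv_on ?I ?d t) (at t within ?I)" if t: "t \<in> ?I" for t
  proof -
    have bd: "B differentiable (at t within ?I)"
      using dB[OF t] by (rule differentiableI_vector)
    have nz: "B t \<noteq> 0" using nB0[OF t] by simp
    have "(\<lambda>x. norm (B x)) differentiable (at t within ?I)"
      using differentiable_compose[OF differentiable_norm_at[OF nz] bd] .
    then have "(\<lambda>x. inverse (norm (B x)) *\<^sub>R B x) differentiable (at t within ?I)"
      by (intro differentiable_scaleR differentiable_inverse bd) (use nz in auto)
    then obtain v where "((\<lambda>x. inverse (norm (B x)) *\<^sub>R B x) has_vector_derivative v) (at t within ?I)"
      using vector_derivative_works by blast
    moreover have "?d x = inverse (norm (B x)) *\<^sub>R B x" if "x \<in> ?I" for x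
    proof -
      have "inverse (norm (B x)) *\<^sub>R (norm (B x) *\<^sub>R ?d x) = ?d x"
        using nB0[OF that] by simp
      then show ?thesis using Bnd[OF that] by metis
    qed
    ultimately have "(?d has_vector_derivative v) (at t within ?I)"
      by (rule has_vector_derivative_transform[OF t, rotated])
    then have "?d differentiable (at t within ?I)"
      by (rule differentiableI_vector)
    then show ?thesis by (simp add: vector_derivative_works deriv_on_def)
  qed
  have y_cross: "?y t = cross3 (?d t) (?e t)" if "t \<in> ?I" for t
    using Lagrange[of "?e t" "?e t" "?y t"] e1[OF that] ey[OF that]
    by (simp add: D_field_def cross_skew[of "cross3 (?e t) (?y t)"] norm_eq_1)
  have dy: "(?y has_vector_derivative deriv_on ?I ?y t) (at t within ?I)" if t: "t \<in> ?I" for t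
  proof -
    from bounded_bilinear.has_vector_derivative[OF bounded_bilinear_cross3 dd[OF t] de[OF t]]
    have "?y differentiable (at t within ?I)"
      by (intro differentiableI_vector) (rule has_vector_derivative_transform[OF t y_cross])
    then show ?thesis by (simp add: vector_derivative_works deriv_on_def)
  qed
  have expand: "v = (v \<bullet> ?e t) *\<^sub>R ?e t + (v \<bullet> ?y t) *\<^sub>R ?y t + (v \<bullet> ?d t) *\<^sub>R ?d t"
    if "t \<in> ?I" for v t
    using orthonormal_expansion[OF e1 y1 ey, OF that that that] by (simp add: D_field_def)
  have h: "deriv_on ?I ?y t \<bullet> ?d t = - h t" if t: "t \<in> ?I" for t
  proof -
    have z: "B x \<bullet> ?y x = 0" if "x \<in> ?I" for x
      using dy0[of x] Bnd[OF that] by (metis inner_scaleR_left mult_zero_right)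
    have "B t \<bullet> deriv_on ?I ?y t + cross3 (?F 1 t) (?F 3 t) \<bullet> ?y t = 0"
      by (rule inner_const_deriv[OF M t dB[OF t] dy[OF t] z])
    moreover have "B t \<bullet> deriv_on ?I ?y t = norm (B t) * (?d t \<bullet> deriv_on ?I ?y t)"
      using Bnd[OF t] by (metis inner_scaleR_left)
    ultimately show ?thesis
      using nB0[OF t] by (simp add: h_def field_simps inner_commute)
  qed
  have Dd: "deriv_on ?I ?d t = h t *\<^sub>R ?y t" if t: "t \<in> ?I" for t
  proof -
    have "deriv_on ?I ?d t \<bullet> ?d t = 0"
      using inner_const_deriv[OF M t dd[OF t] dd[OF t], of 1] d1
      by (simp add: norm_eq_1 inner_commute)
    moreover have "deriv_on ?I ?d t \<bullet> ?e t = 0"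
      using inner_const_deriv[OF M t dd[OF t] de[OF t], of 0] de0 dy0[of t] wy[OF t]
      by (simp add: inner_commute)
    moreover have "deriv_on ?I ?d t \<bullet> ?y t = h t"
      using inner_const_deriv[OF M t dd[OF t] dy[OF t], of 0] dy0 h[OF t]
      by (simp add: inner_commute)
    ultimately show ?thesis by (subst expand[OF t, of "deriv_on ?I ?d t"]) simp
  qed
  have Dy: "deriv_on ?I ?y t = - w t *\<^sub>R ?e t - h t *\<^sub>R ?d t" if t: "t \<in> ?I" for t
  proof -
    have "deriv_on ?I ?y t \<bullet> ?y t = 0"
      using inner_const_deriv[OF M t dy[OF t] dy[OF t], of 1] y1
      by (simp add: norm_eq_1 inner_commute)
    moreover have "deriv_on ?I ?y t \<bullet> ?e t = - w t"
      using inner_const_deriv[OF M t dy[OF t] de[OF t], of 0] ey wy[OF t] y1[OF t]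
      by (simp add: inner_commute norm_eq_1)
    ultimately show ?thesis by (subst expand[OF t, of "deriv_on ?I ?y t"]) (simp add: h[OF t])
  qed
  have contB: "continuous_on ?I B" and conty: "continuous_on ?I ?y"
    by (rule has_vector_derivative_imp_continuous_on[OF dB], assumption)
      (rule has_vector_derivative_imp_continuous_on[OF dy])
  have "continuous_on ?I (\<lambda>t. norm (B t) / (norm (?F 1 t))\<^sup>2)"
    by (intro continuous_intros contB contF) (use pos in \<open>auto simp: K1_def\<close>)
  moreover have "w t = norm (B t) / (norm (?F 1 t))\<^sup>2" if "t \<in> ?I" for t
    using nB[OF that] pos[OF that] by (simp add: K1_def)
  ultimately have contw: "continuous_on ?I w"
    by (subst continuous_on_cong[OF refl])
  have conth: "continuous_on ?I h"
    unfolding h_def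
    by (intro continuous_intros contB conty contF
        bounded_bilinear.continuous_on[OF bounded_bilinear_cross3])
      (use nB0 in auto)
  show ?thesis
  proof (rule that[OF contw conth wpos e1 y1 d1 ey])
    fix t assume t: "t \<in> ?I"
    show "(?e has_vector_derivative w t *\<^sub>R ?y t) (at t within ?I)"
      using de[OF t] unfolding wy[OF t] .
    show "(?y has_vector_derivative - w t *\<^sub>R ?e t - h t *\<^sub>R ?d t) (at t within ?I)"
      using dy[OF t] unfolding Dy[OF t] .
    show "(?d has_vector_derivative h t *\<^sub>R ?y t) (at t within ?I)"
      using dd[OF t] unfolding Dd[OF t] .
  qed
qed

section \<open>Darboux helices and slant helices\<close>

theorem corollary11:
  fixes M :: myller
  assumes "myller_configuration M"
    and "\<forall>s\<in>param M. K1 M s > 0"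
  shows "darboux_helix M \<longleftrightarrow> slant_helix M"
proof -
  let ?I = "param M" let ?e = "xi2 M" and ?y = "Y_field M" and ?d = "D_field M"
  note M = assms(1)
  have pos: "\<And>t. t \<in> ?I \<Longrightarrow> K1 M t > 0" using assms(2) by blast
  obtain w h where cont: "continuous_on ?I w" "continuous_on ?I h"
    and w: "\<And>t. t \<in> ?I \<Longrightarrow> w t > 0"
    and e1: "\<And>t. t \<in> ?I \<Longrightarrow> norm (?e t) = 1"
    and y1: "\<And>t. t \<in> ?I \<Longrightarrow> norm (?y t) = 1"
    and d1: "\<And>t. t \<in> ?I \<Longrightarrow> norm (?d t) = 1"
    and ey: "\<And>t. t \<in> ?I \<Longrightarrow> ?e t \<bullet> ?y t = 0"
    and de: "\<And>t. t \<in> ?I \<Longrightarrow> (?e has_vector_derivative w t *\<^sub>R ?y t) (at t within ?I)"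
    and dy: "\<And>t. t \<in> ?I \<Longrightarrow>
      (?y has_vector_derivative - w t *\<^sub>R ?e t - h t *\<^sub>R ?d t) (at t within ?I)"
    and dd: "\<And>t. t \<in> ?I \<Longrightarrow> (?d has_vector_derivative h t *\<^sub>R ?y t) (at t within ?I)"
    by (rule darboux_frame[OF M pos]) blast+
  have int: "is_interval ?I" using M by (simp add: myller_configuration_def)
  then have conv: "convex ?I" and conn: "connected ?I"
    by (auto simp: is_interval_convex is_interval_connected)
  have inner_deriv: "((\<lambda>t. v t \<bullet> u) has_vector_derivative v' \<bullet> u) (at t within ?I)"
    if "(v has_vector_derivative v') (at t within ?I)" for v :: "real \<Rightarrow> real^3" and v' u t
    using bounded_linear.has_vector_derivative[OF bounded_linear_inner_left that] .
  have slant_iff: "slant_helix M \<longleftrightarrow> (\<exists>u c. norm u = 1 \<and> (\<forall>t\<in>?I. ?e t \<bullet> u = c))"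
    unfolding slant_helix_def
    by (simp add: constant_angle_iff_constant_inner[of ?I ?e, OF e1] cong: conj_cong)
  have darboux_iff: "darboux_helix M \<longleftrightarrow> (\<exists>u c. norm u = 1 \<and> (\<forall>t\<in>?I. ?d t \<bullet> u = c))"
    unfolding darboux_helix_def
    by (simp add: constant_angle_iff_constant_inner[of ?I ?d, OF d1] cong: conj_cong)
  show ?thesis
  proof
    assume "slant_helix M"
    then obtain u c where u: "norm u = 1" and c: "\<And>t. t \<in> ?I \<Longrightarrow> ?e t \<bullet> u = c"
      unfolding slant_iff by blast
    have "?y t \<bullet> u = 0" if t: "t \<in> ?I" for t
      using inner_const_deriv[OF M t de[OF t] has_vector_derivative_const c] w[OF t] by simp
    then have "((\<lambda>t. ?d t \<bullet> u) has_vector_derivative 0) (at t within ?I)" if "t \<in> ?I" for t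
      using inner_deriv[OF dd[OF that], of u] that by simp
    from has_vector_derivative_zero_constant[OF conv this]
    show "darboux_helix M"
      unfolding darboux_iff using u by metis
  next
    assume "darboux_helix M"
    then obtain u c where u: "norm u = 1" and c: "\<And>t. t \<in> ?I \<Longrightarrow> ?d t \<bullet> u = c"
      unfolding darboux_iff by blast
    have hy: "h t * (?y t \<bullet> u) = 0" if t: "t \<in> ?I" for t
      using inner_const_deriv[OF M t dd[OF t] has_vector_derivative_const c] by simp
    have ed: "?e t \<bullet> ?d t = 0" for t
      by (simp add: D_field_def dot_cross_self)
    show "slant_helix M"
    proof (cases "\<exists>s\<in>?I. ?e s \<bullet> u = 0 \<and> ?y s \<bullet> u = 0")
      case True
      then obtain s where s: "s \<in> ?I" "?e s \<bullet> u = 0" "?y s \<bullet> u = 0" by blast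
      have "u = (u \<bullet> ?e s) *\<^sub>R ?e s + (u \<bullet> ?y s) *\<^sub>R ?y s + (u \<bullet> ?d s) *\<^sub>R ?d s"
        using orthonormal_expansion[OF e1 y1 ey, OF s(1) s(1) s(1)] by (simp add: D_field_def)
      also have "\<dots> = c *\<^sub>R ?d s"
        using s c[OF s(1)] by (simp add: inner_commute)
      finally have "norm u = norm (c *\<^sub>R ?d s)" by (rule arg_cong)
      then have "c\<^sup>2 = 1"
        using u d1[OF s(1)] by (simp add: abs_square_eq_1)
      have "?e t \<bullet> u = 0" if t: "t \<in> ?I" for t
      proof -
        \<comment> \<open>equality case of the Cauchy-Schwarz inequality\<close>
        have "(norm (u - c *\<^sub>R ?d t))\<^sup>2 = 0"
          unfolding power2_norm_eq_inner using u d1[OF t] c[OF t] \<open>c\<^sup>2 = 1\<close>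
          by (simp add: norm_eq_1 inner_diff_left inner_diff_right inner_commute
              power2_eq_square del: inner_eq_zero_iff)
        then have "u = c *\<^sub>R ?d t" by simp
        then show ?thesis using ed by simp
      qed
      then show ?thesis unfolding slant_iff using u by blast
    next
      case False
      have "(\<forall>t\<in>?I. h t = 0) \<or> (\<forall>t\<in>?I. h t \<noteq> 0)"
      proof (rule nowhere_or_everywhere_nonzero[where f = "\<lambda>t. ?e t \<bullet> u"
            and g = "\<lambda>t. ?y t \<bullet> u" and w = w and c = c])
        show "continuous_on ?I (\<lambda>t. ?e t \<bullet> u)"
          by (rule has_vector_derivative_imp_continuous_on[OF inner_deriv[OF de]])
        show "((\<lambda>t. ?y t \<bullet> u) has_vector_derivative - (w t * (?e t \<bullet> u)) - h t * c)
            (at t within ?I)" if "t \<in> ?I" for t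
          using inner_deriv[OF dy[OF that], of u] c[OF that] by (simp add: inner_diff_left)
        show "w t \<noteq> 0" if "t \<in> ?I" for t
          using w[OF that] by simp
      qed (use cont conn hy False param_nontrivial[OF M] in blast)+
      then show ?thesis
      proof
        assume "\<forall>t\<in>?I. h t = 0"
        then have "(?d has_vector_derivative 0) (at t within ?I)" if "t \<in> ?I" for t
          using dd[OF that] that by simp
        then obtain a where a: "\<And>t. t \<in> ?I \<Longrightarrow> ?d t = a"
          using has_vector_derivative_zero_constant[OF conv] by metis
        obtain s where "s \<in> ?I"
          using M interior_subset by (fastforce simp: myller_configuration_def)
        then have "norm a = 1" using a d1 by metis
        moreover have "\<forall>t\<in>?I. ?e t \<bullet> a = 0" using a ed by metis
        ultimately show ?thesis unfolding slant_iff by blast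
      next
        assume "\<forall>t\<in>?I. h t \<noteq> 0"
        then have "((\<lambda>t. ?e t \<bullet> u) has_vector_derivative 0) (at t within ?I)" if "t \<in> ?I" for t
          using inner_deriv[OF de[OF that], of u] hy[OF that] that by simp
        from has_vector_derivative_zero_constant[OF conv this]
        show ?thesis unfolding slant_iff using u by metis
      qed
    qed
  qed
qed

end
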